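(* Let $G=(V,E)$ be a finite undirected multigraph with $n=|V|$ and let $B\subseteq E$ be arbitrary. Suppose $K>0$ is such that $c_e\ge K$ for every $e\in B$. Call a nonempty set $F\subseteq B$ a cut-induced subset of $B$ if $F=\delta(S)\cap B$ for some $S\subseteq V$, and let $q(F)=\min\{|\delta(S)|: S\subseteq V,\ \delta(S)\cap B=F\}$. Then for every real $\alpha\ge 1$, $$\bigl|\{F: F \text{ is a cut-induced subset of } B,\ q(F)\le\alpha K\}\bigr|<n^{2\alpha}.$$
   Context: $\delta(S)$ is the set of all edges (counting parallel copies) with exactly one endpoint in $S$, and $|\cdot|$ counts multiplicity. For an edge $e=st$, the effective conductance $c_e$ is the current flowing from $s$ to $t$ when every edge (copy) is a unit resistor and a unit voltage difference is imposed between $s$ and $t$. *)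

theory Defs
  imports Complex_Main
begin

text \<open>A finite undirected multigraph is given by a finite vertex set V, a finite set of
edge identifiers E (parallel copies are distinct identifiers) and an endpoint map
ends :: 'e => 'v * 'v (the orientation of the pair is irrelevant).\<close>

definition cut :: "'e set \<Rightarrow> ('e \<Rightarrow> 'v \<times> 'v) \<Rightarrow> 'v set \<Rightarrow> 'e set" where
  "cut E ends S = {e \<in> E. (fst (ends e) \<in> S) \<noteq> (snd (ends e) \<in> S)}"

definition other_end :: "('e \<Rightarrow> 'v \<times> 'v) \<Rightarrow> 'e \<Rightarrow> 'v \<Rightarrow> 'v" where
  "other_end ends e u = (if fst (ends e) = u then snd (ends e) else fst (ends e))"

text \<open>Net current leaving vertex u under potential phi, every edge a unit resistor (Ohm's law).\<close>
definition net_current :: "'e set \<Rightarrow> ('e \<Rightarrow> 'v \<times> 'v) \<Rightarrow> ('v \<Rightarrow> real) \<Rightarrow> 'v \<Rightarrow> real" where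
  "net_current E ends phi u =
     (\<Sum>f \<in> {f \<in> E. fst (ends f) = u \<or> snd (ends f) = u}. phi u - phi (other_end ends f u))"

definition eff_conductance :: "'v set \<Rightarrow> 'e set \<Rightarrow> ('e \<Rightarrow> 'v \<times> 'v) \<Rightarrow> 'v \<Rightarrow> 'v \<Rightarrow> real" where
  "eff_conductance V E ends s t =
     (THE c. \<exists>phi. phi s = 1 \<and> phi t = 0 \<and>
        (\<forall>u \<in> V - {s, t}. net_current E ends phi u = 0) \<and> c = net_current E ends phi s)"

definition cut_induced :: "'v set \<Rightarrow> 'e set \<Rightarrow> ('e \<Rightarrow> 'v \<times> 'v) \<Rightarrow> 'e set \<Rightarrow> 'e set \<Rightarrow> bool" where
  "cut_induced V E ends B F \<longleftrightarrow> F \<noteq> {} \<and> F \<subseteq> B \<and> (\<exists>S. S \<subseteq> V \<and> cut E ends S \<inter> B = F)"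

definition qval :: "'v set \<Rightarrow> 'e set \<Rightarrow> ('e \<Rightarrow> 'v \<times> 'v) \<Rightarrow> 'e set \<Rightarrow> 'e set \<Rightarrow> nat" where
  "qval V E ends B F = Min {card (cut E ends S) | S. S \<subseteq> V \<and> cut E ends S \<inter> B = F}"

end

(* Let Q be the Dirichlet energy of the network. By Dirichlet's principle, an edge st has
effective conductance at least K iff Q(phi) >= K (phi s - phi t)^2 for all potentials phi, and the
size of a cut is the energy of the indicator of one of its sides. Eliminating a vertex v by the
star-mesh transform minimises Q over the potential of v, and merging two vertices restricts Q to
fewer potentials; so elimination makes no cut heavier, and both operations keep the conductance
bounds.

The count is by Karger's contraction argument with b = 2 alpha. A vertex that meets no edge of B is
eliminated. Otherwise every weighted degree is at least K, so a pair of vertices drawn proportionally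
to its weight is separated by a given light cut with probability at most b / n; merging a random
pair gives N(n) (1 - b / n) <= N(n - 1). For b = m + theta with 0 <= theta < 1 the function
f(n) = n (n - 1) ... (n - m + 1) (n - m)^theta satisfies f(n - 1) <= f(n) (1 - b / n) by Bernoulli's
inequality and f(n) <= n^b, and the induction starts at n = m + 1 with the trivial bound 2^m - 1. *)

theory Submission
  imports Defs "HOL-Analysis.Convex"
begin

subsection \<open>Dirichlet energy and elimination of a vertex\<close>

definition weights :: "('v \<Rightarrow> 'v \<Rightarrow> real) \<Rightarrow> bool" where
  "weights w \<longleftrightarrow> (\<forall>x y. w x y = w y x \<and> 0 \<le> w x y)"

text \<open>Ordered pairs are summed, so every edge counts twice; the factors 2 below stem from
  this.\<close>

definition energy :: "'v set \<Rightarrow> ('v \<Rightarrow> 'v \<Rightarrow> real) \<Rightarrow> ('v \<Rightarrow> real) \<Rightarrow> real" where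
  "energy V w \<phi> = (\<Sum>x\<in>V. \<Sum>y\<in>V. w x y * (\<phi> x - \<phi> y)\<^sup>2)"

definition current :: "'v set \<Rightarrow> ('v \<Rightarrow> 'v \<Rightarrow> real) \<Rightarrow> ('v \<Rightarrow> real) \<Rightarrow> 'v \<Rightarrow> real" where
  "current V w \<phi> x = (\<Sum>y\<in>V. w x y * (\<phi> x - \<phi> y))"

text \<open>If \<open>v\<close> is isolated from \<open>U\<close>, the division by \<open>0\<close> below yields \<open>0\<close>, which leaves the weights
on \<open>U\<close> unchanged. The transform also creates loops; they contribute neither energy nor current.\<close>

definition eliminate :: "'v set \<Rightarrow> ('v \<Rightarrow> 'v \<Rightarrow> real) \<Rightarrow> 'v \<Rightarrow> 'v \<Rightarrow> 'v \<Rightarrow> real" where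
  "eliminate U w v x y = w x y + w x v * w v y / (\<Sum>z\<in>U. w v z)"

text \<open>The value of \<open>\<phi> v\<close> at which no net current flows between
  \<open>v\<close> and \<open>U\<close>, hence a minimiser of the energy in that variable.\<close>

definition avg :: "'v set \<Rightarrow> ('v \<Rightarrow> 'v \<Rightarrow> real) \<Rightarrow> 'v \<Rightarrow> ('v \<Rightarrow> real) \<Rightarrow> real" where
  "avg U w v \<phi> = (\<Sum>z\<in>U. w v z * \<phi> z) / (\<Sum>z\<in>U. w v z)"

lemma weights_sym: "weights w \<Longrightarrow> w x y = w y x"
  and weights_nonneg: "weights w \<Longrightarrow> 0 \<le> w x y"
  by (auto simp: weights_def)

lemma energy_nonneg: "weights w \<Longrightarrow> 0 \<le> energy V w \<phi>"
  unfolding energy_def by (auto simp: weights_nonneg intro!: sum_nonneg mult_nonneg_nonneg)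

lemma energy_cong: "(\<And>x. x \<in> V \<Longrightarrow> \<phi> x = \<psi> x) \<Longrightarrow> energy V w \<phi> = energy V w \<psi>"
  unfolding energy_def by (intro sum.cong refl) auto

lemma current_cong:
  assumes "\<And>y. y \<in> V \<Longrightarrow> \<phi> y = \<psi> y" "x \<in> V"
  shows "current V w \<phi> x = current V w \<psi> x"
  unfolding current_def using assms by (intro sum.cong refl) auto

lemma weights_eliminate:
  assumes "weights w"
  shows "weights (eliminate U w v)"
proof -
  have "0 \<le> (\<Sum>z\<in>U. w v z)" using assms by (intro sum_nonneg weights_nonneg)
  then have "0 \<le> eliminate U w v x y" for x y
    unfolding eliminate_def using assms
    by (intro add_nonneg_nonneg divide_nonneg_nonneg mult_nonneg_nonneg) (auto simp: weights_nonneg)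
  moreover have "eliminate U w v x y = eliminate U w v y x" for x y
    unfolding eliminate_def using weights_sym[OF assms] by (metis mult.commute)
  ultimately show ?thesis unfolding weights_def by blast
qed

text \<open>If the total weight vanishes, nonnegativity makes every single weight vanish, so the
  identity survives the division by zero in \<open>avg\<close>.\<close>

lemma avg_mult:
  assumes "weights w" "finite U"
  shows "(\<Sum>z\<in>U. w v z) * avg U w v \<phi> = (\<Sum>z\<in>U. w v z * \<phi> z)"
proof (cases "(\<Sum>z\<in>U. w v z) = 0")
  case True
  then have "w v z = 0" if "z \<in> U" for z
    using assms that sum_nonneg_eq_0_iff[of U "w v"] by (auto simp: weights_nonneg)
  then show ?thesis by simp
next
  case False
  then show ?thesis by (simp add: avg_def)
qed

lemma avg_upd: "v \<notin> U \<Longrightarrow> avg U w v (\<phi>(v := c)) = avg U w v \<phi>"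
  unfolding avg_def by (auto intro!: arg_cong2[where f="(/)"] sum.cong)

lemma energy_insert:
  assumes "weights w" "finite U" "v \<notin> U"
  shows "energy (insert v U) w \<phi> = energy U w \<phi> + 2 * (\<Sum>y\<in>U. w v y * (\<phi> v - \<phi> y)\<^sup>2)"
proof -
  have "(\<Sum>x\<in>U. w x v * (\<phi> x - \<phi> v)\<^sup>2) = (\<Sum>y\<in>U. w v y * (\<phi> v - \<phi> y)\<^sup>2)"
    by (intro sum.cong refl) (metis power2_commute weights_sym[OF assms(1)])
  then show ?thesis
    unfolding energy_def using assms by (simp add: sum.distrib)
qed

text \<open>Completing the square in \<open>\<phi> v\<close>: the energy is quadratic in this
  variable, minimal at the average, and its minimum is the energy of the star-mesh
  transform.\<close>

lemma energy_eliminate: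
  assumes "weights w" "finite U" "v \<notin> U"
  shows "energy (insert v U) w \<phi> =
    energy U (eliminate U w v) \<phi> + 2 * (\<Sum>z\<in>U. w v z) * (\<phi> v - avg U w v \<phi>)\<^sup>2"
proof -
  let ?W = "\<Sum>z\<in>U. w v z" and ?a = "avg U w v \<phi>"
  let ?A = "\<Sum>z\<in>U. w v z * \<phi> z" and ?S = "\<Sum>z\<in>U. w v z * (\<phi> z)\<^sup>2"
  have WA: "?W * ?a = ?A" using avg_mult[OF assms(1,2)] .
  \<comment> \<open>Up to a factor this is a weighted variance; divided by \<open>?W\<close> it is
    the energy of the added mesh edges.\<close>
  have inner: "(\<Sum>x\<in>U. \<Sum>y\<in>U. w v x * w v y * (\<phi> x - \<phi> y)\<^sup>2) = 2 * ?W * ?S - 2 * ?A\<^sup>2"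
  proof -
    have "(\<Sum>x\<in>U. \<Sum>y\<in>U. w v x * w v y * (\<phi> x - \<phi> y)\<^sup>2)
      = (\<Sum>x\<in>U. \<Sum>y\<in>U. (w v x * (\<phi> x)\<^sup>2) * w v y + w v x * (w v y * (\<phi> y)\<^sup>2)
           - 2 * ((w v x * \<phi> x) * (w v y * \<phi> y)))"
      by (intro sum.cong refl) (simp add: power2_eq_square algebra_simps)
    also have "\<dots> = (\<Sum>x\<in>U. \<Sum>y\<in>U. (w v x * (\<phi> x)\<^sup>2) * w v y)
        + (\<Sum>x\<in>U. \<Sum>y\<in>U. w v x * (w v y * (\<phi> y)\<^sup>2))
        - 2 * (\<Sum>x\<in>U. \<Sum>y\<in>U. (w v x * \<phi> x) * (w v y * \<phi> y))"
      by (simp only: sum.distrib sum_subtractf sum_distrib_left)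
    also have "\<dots> = ?S * ?W + ?W * ?S - 2 * (?A * ?A)"
      by (simp only: sum_product)
    finally show ?thesis by (simp add: power2_eq_square)
  qed
  have "energy U (eliminate U w v) \<phi> =
      (\<Sum>x\<in>U. \<Sum>y\<in>U. w x y * (\<phi> x - \<phi> y)\<^sup>2 + w v x * w v y * (\<phi> x - \<phi> y)\<^sup>2 / ?W)"
    unfolding energy_def eliminate_def
    by (intro sum.cong refl) (simp add: weights_sym[OF assms(1), of _ v] distrib_right)
  also have "\<dots> = energy U w \<phi> + (2 * ?W * ?S - 2 * ?A\<^sup>2) / ?W"
    unfolding energy_def inner[symmetric] by (simp only: sum.distrib sum_divide_distrib)
  also have "(2 * ?W * ?S - 2 * ?A\<^sup>2) / ?W = 2 * ?S - 2 * ?W * ?a\<^sup>2"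
  proof (cases "?W = 0")
    case True
    then have "w v z = 0" if "z \<in> U" for z
      using assms that sum_nonneg_eq_0_iff[of U "w v"] by (auto simp: weights_nonneg)
    then show ?thesis by simp
  next
    case False
    have "(2 * W * S - 2 * (W * a)\<^sup>2) / W = 2 * S - 2 * W * a\<^sup>2" if "W \<noteq> 0" for W S a :: real
      using that by (simp add: field_simps power2_eq_square)
    from this[OF False, of ?S ?a] show ?thesis unfolding WA .
  qed
  finally have E: "energy U (eliminate U w v) \<phi> = energy U w \<phi> + (2 * ?S - 2 * ?W * ?a\<^sup>2)" .
  have "(\<Sum>y\<in>U. w v y * (\<phi> v - \<phi> y)\<^sup>2)
      = (\<Sum>y\<in>U. w v y * (\<phi> v)\<^sup>2 - 2 * \<phi> v * (w v y * \<phi> y) + w v y * (\<phi> y)\<^sup>2)"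
    by (intro sum.cong refl) (simp add: power2_eq_square algebra_simps)
  also have "\<dots> = ?W * (\<phi> v)\<^sup>2 - 2 * \<phi> v * ?A + ?S"
    by (simp only: sum.distrib sum_subtractf sum_distrib_left sum_distrib_right)
  finally have star: "(\<Sum>y\<in>U. w v y * (\<phi> v - \<phi> y)\<^sup>2) = ?W * (\<phi> v)\<^sup>2 - 2 * \<phi> v * (?W * ?a) + ?S"
    unfolding WA .
  have "2 * (W * p\<^sup>2 - 2 * p * (W * a) + S) = (2 * S - 2 * W * a\<^sup>2) + 2 * W * (p - a)\<^sup>2"
    for W S p a :: real by (simp add: power2_eq_square algebra_simps)
  then show ?thesis unfolding energy_insert[OF assms] E star by (simp only: add.assoc)
qed

lemma energy_eliminate_le:
  assumes "weights w" "finite U" "v \<notin> U"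
  shows "energy U (eliminate U w v) \<phi> \<le> energy (insert v U) w \<phi>"
  unfolding energy_eliminate[OF assms]
  using assms by (simp add: sum_nonneg weights_nonneg)

text \<open>The minimum is attained at the average, so a potential on \<open>U\<close> extends to
  \<open>v\<close> at no cost. This carries lower bounds on the energy over to the smaller
  network.\<close>

lemma energy_eliminate_extend:
  assumes "weights w" "finite U" "v \<notin> U"
  obtains \<psi> where "\<And>x. x \<noteq> v \<Longrightarrow> \<psi> x = \<phi> x"
    and "energy (insert v U) w \<psi> = energy U (eliminate U w v) \<phi>"
proof
  let ?\<psi> = "\<phi>(v := avg U w v \<phi>)"
  show "?\<psi> x = \<phi> x" if "x \<noteq> v" for x using that by simp
  have "avg U w v ?\<psi> = avg U w v \<phi>" by (rule avg_upd[OF assms(3)])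
  moreover have "energy U (eliminate U w v) ?\<psi> = energy U (eliminate U w v) \<phi>"
    using assms(3) by (intro energy_cong) auto
  ultimately show "energy (insert v U) w ?\<psi> = energy U (eliminate U w v) \<phi>"
    unfolding energy_eliminate[OF assms] by simp
qed

subsection \<open>The Dirichlet problem and effective conductance\<close>

lemma current_insert:
  assumes "finite U" "v \<notin> U"
  shows "current (insert v U) w \<phi> x = w x v * (\<phi> x - \<phi> v) + current U w \<phi> x"
  using assms by (simp add: current_def)

text \<open>With \<open>v\<close> at its average, the current from \<open>x\<close> to
  \<open>v\<close> splits over the mesh edges, because the drop to \<open>v\<close> is the weighted
  mean of the drops to the vertices of \<open>U\<close>.\<close>

lemma current_eliminate:
  assumes "weights w" "finite U" "v \<notin> U" "x \<in> U" "\<phi> v = avg U w v \<phi>"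
  shows "current (insert v U) w \<phi> x = current U (eliminate U w v) \<phi> x"
proof -
  let ?W = "\<Sum>z\<in>U. w v z"
  have "w x v * (\<phi> x - \<phi> v) = w x v * ((\<Sum>y\<in>U. w v y * (\<phi> x - \<phi> y)) / ?W)"
  proof (cases "?W = 0")
    case True
    then have "w v x = 0"
      using sum_nonneg_eq_0_iff[of U "w v"] assms by (auto simp: weights_nonneg)
    then have "w x v = 0" using weights_sym[OF assms(1)] by metis
    then show ?thesis by simp
  next
    case False
    have "(\<Sum>y\<in>U. w v y * (\<phi> x - \<phi> y)) = ?W * (\<phi> x - \<phi> v)"
      using avg_mult[OF assms(1,2), of v \<phi>] assms(5)
      by (simp add: right_diff_distrib sum_subtractf sum_distrib_right)
    then show ?thesis using False by simp
  qed
  also have "\<dots> + current U w \<phi> x = current U (eliminate U w v) \<phi> x"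
    unfolding current_def eliminate_def
    by (simp add: distrib_right sum.distrib sum_divide_distrib sum_distrib_left mult.assoc)
  finally show ?thesis by (simp add: current_insert[OF assms(2,3)])
qed

lemma current_eliminated:
  assumes "weights w" "finite U" "v \<notin> U" "\<phi> v = avg U w v \<phi>"
  shows "current (insert v U) w \<phi> v = 0"
proof -
  have "current U w \<phi> v = (\<Sum>z\<in>U. w v z) * \<phi> v - (\<Sum>z\<in>U. w v z * \<phi> z)"
    unfolding current_def by (simp only: right_diff_distrib sum_subtractf sum_distrib_right)
  then show ?thesis
    using avg_mult[OF assms(1,2), of v \<phi>] assms(4) by (simp add: current_insert[OF assms(2,3)])
qed

text \<open>Induction on the interior vertices: eliminate one, solve the smaller network, then give
  the eliminated vertex its average. The network changes on the way, so \<open>V\<close> and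
  \<open>w\<close> are generalised.\<close>

lemma dirichlet_problem:
  assumes "finite V" "U \<subseteq> V" "weights w"
  shows "\<exists>\<phi>. (\<forall>x. x \<notin> U \<longrightarrow> \<phi> x = g x) \<and> (\<forall>x\<in>U. current V w \<phi> x = 0)"
  using finite_subset[OF assms(2,1)] assms
proof (induction U arbitrary: V w rule: finite_induct)
  case empty
  then show ?case by auto
next
  case (insert v U)
  obtain X where V: "V = insert v X" and vX: "v \<notin> X"
    using insert.prems(2) by (meson Set.set_insert insert_subset)
  have fin: "finite X" and UX: "U \<subseteq> X" using insert.prems insert.hyps V vX by auto
  from insert.IH[OF fin UX weights_eliminate[OF insert.prems(3)]]
  obtain \<phi> where \<phi>: "\<And>x. x \<notin> U \<Longrightarrow> \<phi> x = g x"
    and curr: "\<And>x. x \<in> U \<Longrightarrow> current X (eliminate X w v) \<phi> x = 0" by blast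
  define \<psi> where "\<psi> = \<phi>(v := avg X w v \<phi>)"
  have \<psi>: "\<psi> v = avg X w v \<psi>" using avg_upd[OF vX] by (simp add: \<psi>_def)
  have \<psi>_out: "\<psi> x = g x" if "x \<notin> insert v U" for x
    using that \<phi> by (simp add: \<psi>_def)
  have "current V w \<psi> x = 0" if "x \<in> U" for x
  proof -
    have "current V w \<psi> x = current X (eliminate X w v) \<psi> x"
      unfolding V using that UX by (intro current_eliminate insert.prems fin vX \<psi>) auto
    also have "\<dots> = current X (eliminate X w v) \<phi> x"
      using vX that UX by (intro current_cong) (auto simp: \<psi>_def)
    finally show ?thesis using curr[OF that] by simp
  qed
  moreover have "current V w \<psi> v = 0"
    unfolding V by (intro current_eliminated insert.prems fin vX \<psi>)
  ultimately show ?case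
    using \<phi> \<psi>_out by (intro exI[of _ \<psi>]) auto
qed

text \<open>Summation by parts, the discrete Green identity; the two orders of a pair contribute
  equally.\<close>

lemma sum_mult_current:
  assumes "weights w"
  shows "(\<Sum>x\<in>V. \<Sum>y\<in>V. w x y * (\<phi> x - \<phi> y) * (\<eta> x - \<eta> y)) = 2 * (\<Sum>x\<in>V. \<eta> x * current V w \<phi> x)"
proof -
  let ?T = "\<lambda>x y. w x y * (\<phi> x - \<phi> y) * \<eta> x"
  have "w x y * (\<phi> x - \<phi> y) * (\<eta> x - \<eta> y) = ?T x y + ?T y x" for x y
    using weights_sym[OF assms, of x y] by (simp add: algebra_simps)
  then have "(\<Sum>x\<in>V. \<Sum>y\<in>V. w x y * (\<phi> x - \<phi> y) * (\<eta> x - \<eta> y))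
      = (\<Sum>x\<in>V. \<Sum>y\<in>V. ?T x y) + (\<Sum>x\<in>V. \<Sum>y\<in>V. ?T y x)"
    by (simp only: sum.distrib)
  also have "(\<Sum>x\<in>V. \<Sum>y\<in>V. ?T y x) = (\<Sum>x\<in>V. \<Sum>y\<in>V. ?T x y)"
    by (rule sum.swap)
  also have "(\<Sum>x\<in>V. \<Sum>y\<in>V. ?T x y) = (\<Sum>x\<in>V. \<eta> x * current V w \<phi> x)"
    unfolding current_def by (simp add: sum_distrib_left mult_ac)
  finally show ?thesis by simp
qed

text \<open>Dirichlet's principle. As \<open>h\<close> has no net current away from \<open>s\<close>
  and \<open>t\<close>, its bilinear pairing with any \<open>\<eta>\<close> depends only on the drop
  of \<open>\<eta>\<close> from \<open>s\<close> to \<open>t\<close>. Subtracting from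
  \<open>\<phi>\<close> the multiple of \<open>h\<close> with the same drop thus removes exactly the
  energy of that multiple, and the rest is nonnegative.\<close>

lemma energy_ge_current:
  assumes "weights w" "finite V" "s \<in> V" "t \<in> V" "s \<noteq> t" "h s = 1" "h t = 0"
    and harm: "\<And>x. x \<in> V - {s, t} \<Longrightarrow> current V w h x = 0"
  shows "2 * current V w h s * (\<phi> s - \<phi> t)\<^sup>2 \<le> energy V w \<phi>"
    and "energy V w h = 2 * current V w h s"
proof -
  let ?d = "\<phi> s - \<phi> t" and ?I = "current V w h"
  have two: "(\<Sum>x\<in>V. \<eta> x * ?I x) = \<eta> s * ?I s + \<eta> t * ?I t" for \<eta> :: "'a \<Rightarrow> real"
  proof -
    have "(\<Sum>x\<in>V. \<eta> x * ?I x) = (\<Sum>x\<in>{s, t}. \<eta> x * ?I x)"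
      using assms by (intro sum.mono_neutral_right) auto
    then show ?thesis using assms by simp
  qed
  \<comment> \<open>The constant test function gives conservation: what leaves \<open>s\<close>
    enters \<open>t\<close>.\<close>
  have "0 = (\<Sum>x\<in>V. (\<lambda>_. 1) x * ?I x)"
    using sum_mult_current[OF assms(1), of h "\<lambda>_. 1" V] by simp
  then have t: "?I t = - ?I s" using two[of "\<lambda>_. 1"] by simp
  have B: "(\<Sum>x\<in>V. \<Sum>y\<in>V. w x y * (h x - h y) * (\<eta> x - \<eta> y)) = 2 * (\<eta> s - \<eta> t) * ?I s" for \<eta>
    unfolding sum_mult_current[OF assms(1)] two t by (simp add: algebra_simps)
  show Eh: "energy V w h = 2 * ?I s"
    using B[of h] assms(6,7) by (simp add: energy_def power2_eq_square mult.assoc)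
  have "energy V w (\<lambda>x. \<phi> x - ?d * h x) =
      (\<Sum>x\<in>V. \<Sum>y\<in>V. w x y * (\<phi> x - \<phi> y)\<^sup>2 - 2 * ?d * (w x y * (h x - h y) * (\<phi> x - \<phi> y))
        + ?d\<^sup>2 * (w x y * (h x - h y)\<^sup>2))"
    unfolding energy_def by (intro sum.cong refl) (simp add: power2_eq_square algebra_simps)
  also have "\<dots> = energy V w \<phi> - 2 * ?d * (2 * ?d * ?I s) + ?d\<^sup>2 * energy V w h"
    unfolding energy_def by (simp only: sum.distrib sum_subtractf flip: sum_distrib_left B)
  also have "\<dots> = energy V w \<phi> - 2 * ?I s * ?d\<^sup>2"
    unfolding Eh by (simp add: power2_eq_square algebra_simps)
  finally show "2 * ?I s * ?d\<^sup>2 \<le> energy V w \<phi>"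
    using energy_nonneg[OF assms(1), of V "\<lambda>x. \<phi> x - ?d * h x"] by linarith
qed

section \<open>Multigraphs as weighted networks\<close>

definition multiplicity :: "'e set \<Rightarrow> ('e \<Rightarrow> 'v \<times> 'v) \<Rightarrow> 'v \<Rightarrow> 'v \<Rightarrow> real" where
  "multiplicity E ends x y = (\<Sum>e\<in>E. of_bool (ends e = (x, y)) + of_bool (ends e = (y, x)))"

lemma weights_multiplicity: "weights (multiplicity E ends)"
  unfolding weights_def multiplicity_def by (auto intro!: sum.cong sum_nonneg)

lemma energy_multiplicity:
  assumes "finite V" "\<And>e. e \<in> E \<Longrightarrow> fst (ends e) \<in> V \<and> snd (ends e) \<in> V"
  shows "energy V (multiplicity E ends) \<phi> = 2 * (\<Sum>e\<in>E. (\<phi> (fst (ends e)) - \<phi> (snd (ends e)))\<^sup>2)"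
proof -
  have pick: "(\<Sum>x\<in>V. \<Sum>y\<in>V. of_bool (p = (x, y)) * f x y) = (f (fst p) (snd p) :: real)"
    if "fst p \<in> V" "snd p \<in> V" for p f
  proof -
    have "(\<Sum>x\<in>V. \<Sum>y\<in>V. of_bool (p = (x, y)) * f x y)
        = (\<Sum>x\<in>V. if x = fst p then \<Sum>y\<in>V. if y = snd p then f x y else 0 else 0)"
      by (intro sum.cong refl) (cases p, auto intro!: sum.cong sum.neutral)
    then show ?thesis using assms(1) that by simp
  qed
  have pick': "(\<Sum>x\<in>V. \<Sum>y\<in>V. of_bool (p = (y, x)) * f x y) = (f (snd p) (fst p) :: real)"
    if "fst p \<in> V" "snd p \<in> V" for p f
    by (subst sum.swap) (rule pick[OF that])
  have "energy V (multiplicity E ends) \<phi> = (\<Sum>x\<in>V. \<Sum>y\<in>V. \<Sum>e\<in>E.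
      of_bool (ends e = (x, y)) * (\<phi> x - \<phi> y)\<^sup>2 + of_bool (ends e = (y, x)) * (\<phi> x - \<phi> y)\<^sup>2)"
    unfolding energy_def multiplicity_def by (simp only: sum_distrib_right distrib_right)
  also have "\<dots> = (\<Sum>e\<in>E. \<Sum>x\<in>V. \<Sum>y\<in>V.
      of_bool (ends e = (x, y)) * (\<phi> x - \<phi> y)\<^sup>2 + of_bool (ends e = (y, x)) * (\<phi> x - \<phi> y)\<^sup>2)"
    by (subst sum.swap[of _ E], subst sum.swap[of _ E V]) (rule refl)
  also have "\<dots> = (\<Sum>e\<in>E. 2 * (\<phi> (fst (ends e)) - \<phi> (snd (ends e)))\<^sup>2)"
    using assms(2) by (intro sum.cong refl) (simp add: sum.distrib pick pick' power2_commute)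
  finally show ?thesis by (simp add: sum_distrib_left)
qed

text \<open>Connects weighted networks with the current that defines effective conductance. An edge
  has distinct ends, so at most one of its two orientations starts at \<open>u\<close>.\<close>

lemma current_multiplicity:
  assumes "finite V" "finite E"
    and "\<And>e. e \<in> E \<Longrightarrow> fst (ends e) \<in> V \<and> snd (ends e) \<in> V \<and> fst (ends e) \<noteq> snd (ends e)"
  shows "current V (multiplicity E ends) \<phi> u = net_current E ends \<phi> u"
proof -
  have pick: "(\<Sum>y\<in>V. of_bool (b \<and> z = y) * f y) = (of_bool b * f z :: real)" if "z \<in> V" for b z f
  proof -
    have "(\<Sum>y\<in>V. of_bool (b \<and> z = y) * f y) = (\<Sum>y\<in>V. if y = z then of_bool b * f y else 0)"
      by (intro sum.cong) auto
    then show ?thesis using assms(1) that by simp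
  qed
  have "current V (multiplicity E ends) \<phi> u = (\<Sum>e\<in>E. \<Sum>y\<in>V.
      of_bool (fst (ends e) = u \<and> snd (ends e) = y) * (\<phi> u - \<phi> y)
      + of_bool (snd (ends e) = u \<and> fst (ends e) = y) * (\<phi> u - \<phi> y))"
    unfolding current_def multiplicity_def sum_distrib_right
    by (subst sum.swap) (simp add: prod_eq_iff distrib_right conj_commute)
  also have "\<dots> = (\<Sum>e\<in>E. of_bool (fst (ends e) = u \<or> snd (ends e) = u) * (\<phi> u - \<phi> (other_end ends e u)))"
  proof (rule sum.cong[OF refl])
    fix e assume "e \<in> E"
    then show "(\<Sum>y\<in>V. of_bool (fst (ends e) = u \<and> snd (ends e) = y) * (\<phi> u - \<phi> y)
      + of_bool (snd (ends e) = u \<and> fst (ends e) = y) * (\<phi> u - \<phi> y))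
      = of_bool (fst (ends e) = u \<or> snd (ends e) = u) * (\<phi> u - \<phi> (other_end ends e u))"
      using assms(3)[of e] by (auto simp: sum.distrib pick other_end_def)
  qed
  also have "\<dots> = net_current E ends \<phi> u"
    unfolding net_current_def using assms(2) by (auto simp: sum.inter_filter intro!: sum.cong)
  finally show ?thesis .
qed

text \<open>Before Dirichlet's principle applies, the definite description in
  \<open>eff_conductance\<close> must be shown to denote: a unit potential exists by the Dirichlet
  problem, and all unit potentials yield the same current.\<close>

lemma energy_ge_eff_conductance:
  assumes "finite V" "finite E"
    and "\<And>e. e \<in> E \<Longrightarrow> fst (ends e) \<in> V \<and> snd (ends e) \<in> V \<and> fst (ends e) \<noteq> snd (ends e)"
    and "s \<in> V" "t \<in> V" "s \<noteq> t"
  shows "2 * eff_conductance V E ends s t * (\<phi> s - \<phi> t)\<^sup>2 \<le> energy V (multiplicity E ends) \<phi>"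
proof -
  let ?w = "multiplicity E ends"
  note W = weights_multiplicity[of E ends]
  note curr = current_multiplicity[OF assms(1-3)]
  obtain h where off: "\<And>x. x \<notin> V - {s, t} \<Longrightarrow> h x = of_bool (x = s)"
    and harm: "\<And>x. x \<in> V - {s, t} \<Longrightarrow> current V ?w h x = 0"
    using dirichlet_problem[OF assms(1) Diff_subset W, of "{s, t}" "\<lambda>x. of_bool (x = s)"] by blast
  have "h s = 1" "h t = 0" using off[of s] off[of t] assms(6) by auto
  note h = this harm
  \<comment> \<open>Each unit potential bounds the energy of the other from below, and energy is
    twice the current. The potentials may differ on components avoiding \<open>s\<close> and
    \<open>t\<close>, but not their currents at \<open>s\<close>.\<close>
  have unique: "current V ?w h' s = current V ?w h s"
    if h': "h' s = 1" "h' t = 0" "\<And>x. x \<in> V - {s, t} \<Longrightarrow> current V ?w h' x = 0" for h'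
    using energy_ge_current(1)[OF W assms(1,4-6) h, of h'] energy_ge_current(1)[OF W assms(1,4-6) h', of h]
      energy_ge_current(2)[OF W assms(1,4-6) h] energy_ge_current(2)[OF W assms(1,4-6) h']
      h h' by simp
  have "eff_conductance V E ends s t = current V ?w h s"
    unfolding eff_conductance_def
  proof (rule the_equality)
    show "\<exists>phi. phi s = 1 \<and> phi t = 0 \<and> (\<forall>u\<in>V - {s, t}. net_current E ends phi u = 0) \<and>
        current V ?w h s = net_current E ends phi s"
      using h curr by (intro exI[of _ h]) auto
  next
    fix c
    assume "\<exists>phi. phi s = 1 \<and> phi t = 0 \<and> (\<forall>u\<in>V - {s, t}. net_current E ends phi u = 0) \<and>
        c = net_current E ends phi s"
    then obtain h' where "h' s = 1" "h' t = 0"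
      "\<And>x. x \<in> V - {s, t} \<Longrightarrow> net_current E ends h' x = 0" "c = net_current E ends h' s"
      by blast
    then show "c = current V ?w h s" using unique[of h'] curr by simp
  qed
  then show ?thesis using energy_ge_current(1)[OF W assms(1,4-6) h] by simp
qed

subsection \<open>Counting light cuts\<close>

text \<open>\<open>m\<close> and \<open>\<theta>\<close> will be the integer and fractional part of
  the exponent; at \<open>n = m + 1\<close> the power is 1.\<close>

definition falling_bound :: "nat \<Rightarrow> real \<Rightarrow> nat \<Rightarrow> real" where
  "falling_bound m \<theta> n = fact n / fact (n - m) * real (n - m) powr \<theta>"

lemma falling_bound_nonneg: "0 \<le> falling_bound m \<theta> n"
  by (simp add: falling_bound_def)

text \<open>Bernoulli's inequality (1 - 1/x)^\<theta> \<le> 1 - \<theta>/x, as the weighted mean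
  inequality for (x - 1)/x and 1.\<close>

lemma powr_diff_one_le:
  fixes x \<theta> :: real
  assumes "1 < x" "0 \<le> \<theta>" "\<theta> \<le> 1"
  shows "x * (x - 1) powr \<theta> \<le> x powr \<theta> * (x - \<theta>)"
proof -
  have "((x - 1) / x) powr \<theta> * 1 powr (1 - \<theta>) \<le> \<theta> * ((x - 1) / x) + (1 - \<theta>) * 1"
    using assms by (intro Youngs_inequality_0) auto
  also have "\<dots> = (x - \<theta>) / x" using assms by (simp add: field_simps)
  finally have "(x - 1) powr \<theta> / x powr \<theta> \<le> (x - \<theta>) / x"
    using assms by (simp add: powr_divide)
  then show ?thesis using assms by (simp add: field_simps)
qed

text \<open>The factorial parts match exactly; the powers are compared by Bernoulli's inequality at
  x = n - m, which is at least 2.\<close>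

lemma falling_bound_step:
  assumes "m + 2 \<le> n" "0 \<le> \<theta>" "\<theta> \<le> 1"
  shows "real n * falling_bound m \<theta> (n - 1) \<le> falling_bound m \<theta> n * (real n - (real m + \<theta>))"
proof -
  obtain k where n: "n = m + 2 + k" using assms(1) le_Suc_ex by blast
  let ?x = "real k + 2" and ?P = "fact n / fact (n - m) :: real"
  have x: "real (n - m) = ?x" "real (n - 1 - m) = ?x - 1" by (simp_all add: n)
  have "real n * (fact (n - 1) / fact (n - 1 - m)) = ?P * ?x"
  proof -
    have "fact n = real n * fact (n - 1)" using n by (intro fact_reduce) simp
    moreover have "fact (n - m) = ?x * (fact (n - 1 - m) :: real)"
      using fact_reduce[of "n - m", where 'a = real] x(1) n by (simp add: diff_commute)
    ultimately show ?thesis by simp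
  qed
  then have "real n * falling_bound m \<theta> (n - 1) = ?P * (?x * (?x - 1) powr \<theta>)"
    unfolding falling_bound_def x by (metis mult.assoc)
  also have "\<dots> \<le> ?P * (?x powr \<theta> * (?x - \<theta>))"
    using assms by (intro mult_left_mono powr_diff_one_le) auto
  also have "\<dots> = falling_bound m \<theta> n * (real n - (real m + \<theta>))"
    unfolding falling_bound_def x by (simp add: n)
  finally show ?thesis .
qed

text \<open>Serves the elimination step, which loses a vertex without averaging.\<close>

lemma falling_bound_mono:
  assumes "m + 2 \<le> n" "0 \<le> \<theta>" "\<theta> \<le> 1"
  shows "falling_bound m \<theta> (n - 1) \<le> falling_bound m \<theta> n"
proof -
  have "falling_bound m \<theta> n * (real n - (real m + \<theta>)) \<le> falling_bound m \<theta> n * real n"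
    using assms falling_bound_nonneg by (intro mult_left_mono) auto
  then have "real n * falling_bound m \<theta> (n - 1) \<le> real n * falling_bound m \<theta> n"
    using falling_bound_step[OF assms] by (simp add: mult.commute)
  then show ?thesis using assms(1) by simp
qed

lemma falling_bound_le_powr:
  assumes "m \<le> n" "0 < n" "0 \<le> \<theta>"
  shows "falling_bound m \<theta> n \<le> real n powr (real m + \<theta>)"
proof -
  have "fact n / fact (n - m) \<le> real n ^ m"
  proof -
    have "real (fact n div fact (n - m)) \<le> real (n ^ m)"
      using fact_div_fact_le_pow[OF assms(1)] by (rule of_nat_mono)
    then show ?thesis
      using fact_dvd[of "n - m" n, where 'a=nat] by (simp add: real_of_nat_div)
  qed
  then have "falling_bound m \<theta> n \<le> real n ^ m * real n powr \<theta>"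
    unfolding falling_bound_def using assms by (intro mult_mono powr_mono2) auto
  then show ?thesis using assms(2) by (simp add: powr_add powr_realpow)
qed

text \<open>Makes the constant of the induction less than 1, the source of strictness when there are
  more than \<open>m\<close> vertices.\<close>

lemma two_power_le_fact: "2 ^ m \<le> (fact (m + 1) :: real)"
proof (induction m)
  case (Suc m)
  have "2 * 2 ^ m \<le> (real m + 2) * fact (m + 1)" using Suc by (intro mult_mono) auto
  then show ?case by (simp add: algebra_simps)
qed simp

text \<open>Complementary sides give the same cut, so a nonempty cut has a nonempty side avoiding a
  fixed vertex.\<close>

lemma card_cuts:
  assumes "finite V" "V \<noteq> {}"
    and "\<forall>e\<in>B. fst (ends e) \<noteq> snd (ends e) \<longrightarrow> fst (ends e) \<in> V \<and> snd (ends e) \<in> V"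
  shows "finite {F. F \<noteq> {} \<and> (\<exists>S. S \<subseteq> V \<and> F = cut B ends S)}"
    and "real (card {F. F \<noteq> {} \<and> (\<exists>S. S \<subseteq> V \<and> F = cut B ends S)}) \<le> 2 ^ (card V - 1) - 1"
proof -
  let ?C = "{F. F \<noteq> {} \<and> (\<exists>S. S \<subseteq> V \<and> F = cut B ends S)}"
  obtain v where v: "v \<in> V" using assms(2) by blast
  let ?P = "Pow (V - {v}) - {{}}"
  have compl: "cut B ends (V - S) = cut B ends S" for S
  proof -
    have "(fst (ends e) \<in> V - S) \<noteq> (snd (ends e) \<in> V - S) \<longleftrightarrow> (fst (ends e) \<in> S) \<noteq> (snd (ends e) \<in> S)"
      if "e \<in> B" for e
      using assms(3) that by (cases "fst (ends e) = snd (ends e)") auto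
    then show ?thesis unfolding cut_def by blast
  qed
  have sub: "?C \<subseteq> cut B ends ` ?P"
  proof
    fix F assume "F \<in> ?C"
    then obtain S where S: "F \<noteq> {}" "S \<subseteq> V" "F = cut B ends S" by blast
    define T where "T = (if v \<in> S then V - S else S)"
    have T: "T \<subseteq> V - {v}" "F = cut B ends T" using S compl by (auto simp: T_def)
    have "T \<noteq> {}" using T S(1) by (auto simp: cut_def)
    then show "F \<in> cut B ends ` ?P" using T by blast
  qed
  have fin: "finite ?P" using assms(1) by simp
  show "finite ?C" using finite_subset[OF sub] fin by blast
  have "card ?C \<le> card ?P"
    using card_mono[OF finite_imageI[OF fin] sub] card_image_le[OF fin] le_trans by blast
  also have "card ?P = 2 ^ (card V - 1) - 1"
    using assms(1) v by (simp add: card_Diff_subset card_Pow)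
  finally have "card ?C \<le> 2 ^ (card V - 1) - 1" .
  then have "real (card ?C) \<le> real (2 ^ (card V - 1) - 1)" by (rule of_nat_mono)
  then show "real (card ?C) \<le> 2 ^ (card V - 1) - 1" by (simp add: of_nat_diff)
qed

section \<open>Networks under vertex maps\<close>

definition push_weights :: "'v set \<Rightarrow> ('v \<Rightarrow> 'v) \<Rightarrow> ('v \<Rightarrow> 'v \<Rightarrow> real) \<Rightarrow> 'v \<Rightarrow> 'v \<Rightarrow> real" where
  "push_weights V h w x y = (\<Sum>u\<in>V. \<Sum>z\<in>V. of_bool (h u = x) * (of_bool (h z = y) * w u z))"

lemma weights_push:
  assumes "weights w"
  shows "weights (push_weights V h w)"
proof -
  have "push_weights V h w x y = push_weights V h w y x" for x y
    unfolding push_weights_def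
    by (subst sum.swap) (simp add: weights_sym[OF assms] mult.left_commute)
  moreover have "0 \<le> push_weights V h w x y" for x y
    unfolding push_weights_def by (intro sum_nonneg) (auto simp: weights_nonneg[OF assms])
  ultimately show ?thesis unfolding weights_def by blast
qed

lemma sum_fibres:
  fixes f :: "'a \<Rightarrow> 'b \<Rightarrow> real"
  assumes "finite Y" "h ` V \<subseteq> Y"
  shows "(\<Sum>y\<in>Y. \<Sum>u\<in>V. of_bool (h u = y) * f y u) = (\<Sum>u\<in>V. f (h u) u)"
proof -
  have "(\<Sum>y\<in>Y. of_bool (h u = y) * f y u) = f (h u) u" if "u \<in> V" for u
  proof -
    have "(\<Sum>y\<in>Y. of_bool (h u = y) * f y u) = (\<Sum>y\<in>Y. if y = h u then f (h u) u else 0)"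
      by (intro sum.cong) auto
    then show ?thesis using assms that by auto
  qed
  then show ?thesis by (subst sum.swap) simp
qed

text \<open>A potential on the image pulls back to one constant on the fibres of \<open>h\<close>;
  merging therefore only restricts the potentials for which an energy bound is claimed.\<close>

lemma energy_push:
  assumes "finite Y" "h ` V \<subseteq> Y"
  shows "energy Y (push_weights V h w) \<phi> = energy V w (\<phi> \<circ> h)"
proof -
  have "(\<Sum>y\<in>Y. push_weights V h w x y * (\<phi> x - \<phi> y)\<^sup>2)
      = (\<Sum>u\<in>V. of_bool (h u = x) * (\<Sum>z\<in>V. w u z * (\<phi> x - \<phi> (h z))\<^sup>2))" for x
  proof -
    have "(\<Sum>y\<in>Y. push_weights V h w x y * (\<phi> x - \<phi> y)\<^sup>2) = (\<Sum>y\<in>Y. \<Sum>u\<in>V. of_bool (h u = x) *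
        (\<Sum>z\<in>V. of_bool (h z = y) * (w u z * (\<phi> x - \<phi> y)\<^sup>2)))"
      unfolding push_weights_def by (simp only: sum_distrib_right sum_distrib_left mult.assoc)
    also have "\<dots> = (\<Sum>u\<in>V. of_bool (h u = x) *
        (\<Sum>y\<in>Y. \<Sum>z\<in>V. of_bool (h z = y) * (w u z * (\<phi> x - \<phi> y)\<^sup>2)))"
      by (subst sum.swap) (simp only: sum_distrib_left)
    finally show ?thesis unfolding sum_fibres[OF assms] .
  qed
  then show ?thesis
    unfolding energy_def by (simp only: sum_fibres[OF assms] o_apply)
qed

text \<open>Double counting behind a random \<open>p\<close> drawn proportionally to
  \<open>w\<close>. Read \<open>R F p\<close> as \<open>p\<close> destroying \<open>F\<close>: this
  has probability at most \<open>b / sum w P\<close>, while each \<open>p\<close> leaves at most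
  \<open>c\<close> survivors.\<close>

lemma card_mult_le_of_average:
  fixes w :: "'p \<Rightarrow> real"
  assumes "finite A" "finite P" "\<And>p. p \<in> P \<Longrightarrow> 0 \<le> w p"
    and "\<And>F. F \<in> A \<Longrightarrow> (\<Sum>p\<in>P. of_bool (R F p) * w p) \<le> b"
    and "\<And>p. p \<in> P \<Longrightarrow> real (card {F \<in> A. \<not> R F p}) \<le> c"
  shows "real (card A) * (sum w P - b) \<le> c * sum w P"
proof -
  have "real (card A) * (sum w P - b) = (\<Sum>F\<in>A. sum w P - b)" by simp
  also have "\<dots> \<le> (\<Sum>F\<in>A. \<Sum>p\<in>P. of_bool (\<not> R F p) * w p)"
  proof (rule sum_mono)
    fix F assume "F \<in> A"
    have "sum w P = (\<Sum>p\<in>P. of_bool (R F p) * w p) + (\<Sum>p\<in>P. of_bool (\<not> R F p) * w p)"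
      unfolding sum.distrib[symmetric] by (intro sum.cong) auto
    then show "sum w P - b \<le> (\<Sum>p\<in>P. of_bool (\<not> R F p) * w p)"
      using assms(4)[OF \<open>F \<in> A\<close>] by linarith
  qed
  also have "\<dots> = (\<Sum>p\<in>P. real (card {F \<in> A. \<not> R F p}) * w p)"
    using assms(1) by (subst sum.swap) (simp add: sum_distrib_right[symmetric] Int_def)
  also have "\<dots> \<le> (\<Sum>p\<in>P. c * w p)"
    using assms(3,5) by (intro sum_mono mult_right_mono) auto
  finally show ?thesis by (simp add: sum_distrib_left)
qed

text \<open>The energy sums over ordered pairs and so counts every edge twice: the energy of an
indicator is twice the weight of the cut, and the bound \<open>K\<close> appears as \<open>2 * K\<close> in
\<open>conductive\<close>.\<close>

definition light_cuts ::
  "'v set \<Rightarrow> ('v \<Rightarrow> 'v \<Rightarrow> real) \<Rightarrow> 'e set \<Rightarrow> ('e \<Rightarrow> 'v \<times> 'v) \<Rightarrow> real \<Rightarrow> 'e set set" where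
  "light_cuts V w B ends b =
     {F. F \<noteq> {} \<and> (\<exists>S. S \<subseteq> V \<and> F = cut B ends S \<and> energy V w (\<lambda>x. of_bool (x \<in> S)) \<le> b)}"

text \<open>The conductance bound in the form given by Dirichlet's principle. Only non-loops must
  end in \<open>V\<close>, since elimination of a vertex leaves behind the loops of \<open>B\<close>
  at it.\<close>

definition conductive ::
  "'v set \<Rightarrow> ('v \<Rightarrow> 'v \<Rightarrow> real) \<Rightarrow> 'e set \<Rightarrow> ('e \<Rightarrow> 'v \<times> 'v) \<Rightarrow> real \<Rightarrow> bool" where
  "conductive V w B ends K \<longleftrightarrow>
     (\<forall>e\<in>B. fst (ends e) \<noteq> snd (ends e) \<longrightarrow> fst (ends e) \<in> V \<and> snd (ends e) \<in> V) \<and>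
     (\<forall>e\<in>B. \<forall>\<phi>. 2 * K * (\<phi> (fst (ends e)) - \<phi> (snd (ends e)))\<^sup>2 \<le> energy V w \<phi>)"

section \<open>Light cuts under elimination and merging\<close>

lemma conductiveD:
  "conductive V w B ends K \<Longrightarrow> e \<in> B \<Longrightarrow>
    2 * K * (\<phi> (fst (ends e)) - \<phi> (snd (ends e)))\<^sup>2 \<le> energy V w \<phi>"
  by (simp add: conductive_def)

text \<open>Extend the potential to \<open>v\<close> at equal energy; non-loops of \<open>B\<close>
  avoid \<open>v\<close>, so their drops are unchanged.\<close>

lemma conductive_eliminate:
  assumes "conductive (insert v U) w B ends K" "weights w" "finite U" "v \<notin> U"
    and "\<forall>e\<in>B. fst (ends e) \<noteq> snd (ends e) \<longrightarrow> fst (ends e) \<noteq> v \<and> snd (ends e) \<noteq> v"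
  shows "conductive U (eliminate U w v) B ends K"
  unfolding conductive_def
proof (intro conjI ballI allI impI)
  fix e assume e: "e \<in> B" and ne: "fst (ends e) \<noteq> snd (ends e)"
  then have "fst (ends e) \<in> insert v U \<and> snd (ends e) \<in> insert v U"
    using assms(1) unfolding conductive_def by blast
  then show "fst (ends e) \<in> U" "snd (ends e) \<in> U" using assms(5) e ne by auto
next
  fix e \<phi> assume e: "e \<in> B"
  show "2 * K * (\<phi> (fst (ends e)) - \<phi> (snd (ends e)))\<^sup>2 \<le> energy U (eliminate U w v) \<phi>"
  proof (cases "fst (ends e) = snd (ends e)")
    case True
    then show ?thesis using energy_nonneg[OF weights_eliminate[OF assms(2)]] by simp
  next
    case False
    obtain \<psi> where \<psi>: "\<And>x. x \<noteq> v \<Longrightarrow> \<psi> x = \<phi> x"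
      "energy (insert v U) w \<psi> = energy U (eliminate U w v) \<phi>"
      using energy_eliminate_extend[OF assms(2-4)] by blast
    have "2 * K * (\<psi> (fst (ends e)) - \<psi> (snd (ends e)))\<^sup>2 \<le> energy (insert v U) w \<psi>"
      by (rule conductiveD[OF assms(1) e])
    then show ?thesis using \<psi> assms(5) e False by simp
  qed
qed

text \<open>Only loops of \<open>B\<close> can touch \<open>v\<close>, so dropping \<open>v\<close>
  from a side keeps the cut in \<open>B\<close>, while elimination does not raise the
  energy.\<close>

lemma light_cuts_eliminate:
  assumes "weights w" "finite U" "v \<notin> U"
    and "\<forall>e\<in>B. fst (ends e) \<noteq> snd (ends e) \<longrightarrow> fst (ends e) \<noteq> v \<and> snd (ends e) \<noteq> v"
  shows "light_cuts (insert v U) w B ends b \<subseteq> light_cuts U (eliminate U w v) B ends b"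
proof
  fix F assume "F \<in> light_cuts (insert v U) w B ends b"
  then obtain S where S: "F \<noteq> {}" "S \<subseteq> insert v U" "F = cut B ends S"
    "energy (insert v U) w (\<lambda>x. of_bool (x \<in> S)) \<le> b"
    unfolding light_cuts_def by blast
  have "F = cut B ends (S - {v})"
  proof -
    have "(fst (ends e) \<in> S - {v}) \<noteq> (snd (ends e) \<in> S - {v})
        \<longleftrightarrow> (fst (ends e) \<in> S) \<noteq> (snd (ends e) \<in> S)" if "e \<in> B" for e
      using assms(4) that by (cases "fst (ends e) = snd (ends e)") auto
    then show ?thesis unfolding S(3) cut_def by blast
  qed
  moreover have "energy U (eliminate U w v) (\<lambda>x. of_bool (x \<in> S - {v}))
      = energy U (eliminate U w v) (\<lambda>x. of_bool (x \<in> S))"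
    using assms(3) by (intro energy_cong) auto
  moreover have "\<dots> \<le> b"
    using energy_eliminate_le[OF assms(1-3)] S(4) by (rule order_trans)
  ultimately show "F \<in> light_cuts U (eliminate U w v) B ends b"
    unfolding light_cuts_def using S(1,2) by (auto intro!: exI[of _ "S - {v}"])
qed

text \<open>Merging changes the endpoint map but not the edge identifiers, so a surviving cut stays
  literally the same set.\<close>

abbreviation merge :: "'v \<Rightarrow> 'v \<Rightarrow> 'v \<Rightarrow> 'v" where
  "merge a b \<equiv> id(b := a)"

lemma conductive_merge:
  assumes "conductive V w B ends K" "finite V" "a \<in> V" "a \<noteq> b"
  shows "conductive (V - {b}) (push_weights V (merge a b) w) B
           (map_prod (merge a b) (merge a b) \<circ> ends) K"
  unfolding conductive_def
proof (intro conjI ballI allI impI)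
  fix e
  assume e: "e \<in> B" and "fst ((map_prod (merge a b) (merge a b) \<circ> ends) e)
    \<noteq> snd ((map_prod (merge a b) (merge a b) \<circ> ends) e)"
  then have "fst (ends e) \<noteq> snd (ends e)" by (metis comp_apply fst_map_prod snd_map_prod)
  then have "fst (ends e) \<in> V \<and> snd (ends e) \<in> V" using assms(1) e unfolding conductive_def by blast
  then show "fst ((map_prod (merge a b) (merge a b) \<circ> ends) e) \<in> V - {b}"
    "snd ((map_prod (merge a b) (merge a b) \<circ> ends) e) \<in> V - {b}"
    using assms(3,4) by auto
next
  fix e and \<phi> :: "'a \<Rightarrow> real" assume e: "e \<in> B"
  have "merge a b ` V \<subseteq> V - {b}" using assms(3,4) by auto
  then have "energy (V - {b}) (push_weights V (merge a b) w) \<phi> = energy V w (\<phi> \<circ> merge a b)"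
    using assms(2) by (intro energy_push) auto
  moreover have "2 * K * ((\<phi> \<circ> merge a b) (fst (ends e)) - (\<phi> \<circ> merge a b) (snd (ends e)))\<^sup>2
      \<le> energy V w (\<phi> \<circ> merge a b)"
    by (rule conductiveD[OF assms(1) e])
  ultimately show "2 * K * (\<phi> (fst ((map_prod (merge a b) (merge a b) \<circ> ends) e))
      - \<phi> (snd ((map_prod (merge a b) (merge a b) \<circ> ends) e)))\<^sup>2
      \<le> energy (V - {b}) (push_weights V (merge a b) w) \<phi>"
    by (simp only: o_apply fst_map_prod snd_map_prod)
qed

text \<open>If \<open>a\<close> and \<open>b\<close> are on the same side, \<open>S\<close> is the
  preimage of \<open>S - {b}\<close> under the merge, which preserves both cut and energy.\<close>

lemma light_cut_merge:
  assumes "finite V" "a \<in> V" "a \<noteq> b"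
    and S: "S \<subseteq> V" "cut B ends S \<noteq> {}" "energy V w (\<lambda>x. of_bool (x \<in> S)) \<le> c" "a \<in> S \<longleftrightarrow> b \<in> S"
  shows "cut B ends S \<in> light_cuts (V - {b}) (push_weights V (merge a b) w) B
           (map_prod (merge a b) (merge a b) \<circ> ends) c"
proof -
  have mem: "merge a b x \<in> S - {b} \<longleftrightarrow> x \<in> S" for x using S(4) assms(3) by auto
  have "merge a b ` V \<subseteq> V - {b}" using assms(2,3) by auto
  then have "energy (V - {b}) (push_weights V (merge a b) w) (\<lambda>x. of_bool (x \<in> S - {b}))
      = energy V w ((\<lambda>x. of_bool (x \<in> S - {b})) \<circ> merge a b)"
    using assms(1) by (intro energy_push) auto
  also have "\<dots> = energy V w (\<lambda>x. of_bool (x \<in> S))"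
    by (simp only: o_def mem)
  finally have "energy (V - {b}) (push_weights V (merge a b) w) (\<lambda>x. of_bool (x \<in> S - {b})) \<le> c"
    using S(3) by simp
  moreover have "cut B (map_prod (merge a b) (merge a b) \<circ> ends) (S - {b}) = cut B ends S"
    unfolding cut_def by (simp only: o_apply fst_map_prod snd_map_prod mem)
  ultimately show ?thesis
    unfolding light_cuts_def using S(1,2) by (intro CollectI conjI exI[of _ "S - {b}"]) auto
qed

lemma finite_light_cuts:
  assumes "finite V"
  shows "finite (light_cuts V w B ends b)"
proof (rule finite_subset)
  show "light_cuts V w B ends b \<subseteq> cut B ends ` Pow V" unfolding light_cuts_def by blast
qed (use assms in simp)

section \<open>Weights of vertex pairs and the induction\<close>

lemma energy_singleton:
  assumes "weights w" "finite V" "v \<in> V"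
  shows "energy V w (\<lambda>x. of_bool (x = v)) = 2 * (\<Sum>y\<in>V - {v}. w v y)"
proof -
  have "energy (insert v (V - {v})) w (\<lambda>x. of_bool (x = v)) = 2 * (\<Sum>y\<in>V - {v}. w v y)"
    using energy_insert[OF assms(1), of "V - {v}" v "\<lambda>x. of_bool (x = v)"] assms(2)
    by (simp add: energy_def)
  then show ?thesis using assms(3) by (simp add: insert_absorb)
qed

text \<open>Test the energy bound with the indicator of \<open>v\<close>: a non-loop of
  \<open>B\<close> at \<open>v\<close> has drop of size 1, so the weighted degree is at least
  \<open>K\<close>. Then sum over \<open>v\<close>.\<close>

lemma total_weight_ge:
  assumes "conductive V w B ends K" "weights w" "finite V"
    and "\<And>v. v \<in> V \<Longrightarrow> \<exists>e\<in>B. fst (ends e) \<noteq> snd (ends e) \<and> (fst (ends e) = v \<or> snd (ends e) = v)"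
  shows "real (card V) * K \<le> (\<Sum>p\<in>Sigma V (\<lambda>x. V - {x}). w (fst p) (snd p))"
proof -
  have "K \<le> (\<Sum>y\<in>V - {v}. w v y)" if v: "v \<in> V" for v
  proof -
    obtain e where e: "e \<in> B" "fst (ends e) \<noteq> snd (ends e)" "fst (ends e) = v \<or> snd (ends e) = v"
      using assms(4)[OF v] by blast
    let ?\<phi> = "\<lambda>x. of_bool (x = v) :: real"
    have "2 * K * (?\<phi> (fst (ends e)) - ?\<phi> (snd (ends e)))\<^sup>2 \<le> energy V w ?\<phi>"
      by (rule conductiveD[OF assms(1) e(1)])
    moreover have "(?\<phi> (fst (ends e)) - ?\<phi> (snd (ends e)))\<^sup>2 = 1" using e(2,3) by auto
    ultimately show ?thesis using energy_singleton[OF assms(2,3) v] by simp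
  qed
  then have "(\<Sum>v\<in>V. K) \<le> (\<Sum>v\<in>V. \<Sum>y\<in>V - {v}. w v y)" by (rule sum_mono)
  then show ?thesis using assms(3) by (simp add: sum.Sigma split_def)
qed

text \<open>The squared drop is 1 on separated pairs and 0 on the others. Relative to the total
  weight, this is the probability that a random pair is separated.\<close>

lemma energy_of_bool:
  assumes "finite V"
  shows "(\<Sum>p\<in>Sigma V (\<lambda>x. V - {x}). of_bool ((fst p \<in> S) \<noteq> (snd p \<in> S)) * w (fst p) (snd p))
    = energy V w (\<lambda>x. of_bool (x \<in> S))"
proof -
  have "(\<Sum>y\<in>V - {x}. of_bool ((x \<in> S) \<noteq> (y \<in> S)) * w x y)
      = (\<Sum>y\<in>V. w x y * (of_bool (x \<in> S) - of_bool (y \<in> S))\<^sup>2)" for x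
    using assms by (intro sum.mono_neutral_cong_left) auto
  moreover have "(\<Sum>p\<in>Sigma V (\<lambda>x. V - {x}). of_bool ((fst p \<in> S) \<noteq> (snd p \<in> S)) * w (fst p) (snd p))
      = (\<Sum>x\<in>V. \<Sum>y\<in>V - {x}. of_bool ((x \<in> S) \<noteq> (y \<in> S)) * w x y)"
    by (subst sum.Sigma) (use assms in \<open>simp_all add: split_def\<close>)
  ultimately show ?thesis unfolding energy_def by (simp only:)
qed

lemma card_light_cuts_le:
  assumes "finite V" "V \<noteq> {}" "conductive V w B ends K"
  shows "real (card (light_cuts V w B ends b)) \<le> 2 ^ (card V - 1) - 1"
proof -
  let ?C = "{F. F \<noteq> {} \<and> (\<exists>S. S \<subseteq> V \<and> F = cut B ends S)}"
  have ends: "\<forall>e\<in>B. fst (ends e) \<noteq> snd (ends e) \<longrightarrow> fst (ends e) \<in> V \<and> snd (ends e) \<in> V"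
    using assms(3) unfolding conductive_def by blast
  have "light_cuts V w B ends b \<subseteq> ?C" unfolding light_cuts_def by blast
  then have "card (light_cuts V w B ends b) \<le> card ?C"
    by (rule card_mono[OF card_cuts(1)[OF assms(1,2) ends]])
  then have "real (card (light_cuts V w B ends b)) \<le> real (card ?C)" by (rule of_nat_mono)
  also have "\<dots> \<le> 2 ^ (card V - 1) - 1" by (rule card_cuts(2)[OF assms(1,2) ends])
  finally show ?thesis .
qed

text \<open>The constant makes the claim the trivial bound at \<open>m + 1\<close> vertices. Each
  further vertex is removed by elimination or by averaging over all merges, with \<open>K\<close>
  unchanged.\<close>

lemma card_light_cuts:
  assumes "finite V" "weights w" "conductive V w B ends K" "0 < K" "0 \<le> \<theta>" "\<theta> < 1" "m + 1 \<le> card V"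
  shows "real (card (light_cuts V w B ends ((real m + \<theta>) * K)))
    \<le> (2 ^ m - 1) / fact (m + 1) * falling_bound m \<theta> (card V)"
  using assms(1-3) assms(7)
proof (induction "card V - (m + 1)" arbitrary: V w ends)
  case base: 0
  have base_card: "card V = m + 1" using base by simp
  have V: "V \<noteq> {}" using base_card by auto
  have "real (card (light_cuts V w B ends ((real m + \<theta>) * K))) \<le> 2 ^ (card V - 1) - 1"
    by (rule card_light_cuts_le[OF base.prems(1) V base.prems(3)])
  moreover have "falling_bound m \<theta> (card V) = fact (m + 1)"
    unfolding falling_bound_def base_card by simp
  ultimately show ?case using base_card by simp
next
  case step: (Suc k)
  define n where "n = card V - 1"
  let ?b = "(real m + \<theta>) * K"
  define c where "c = (2 ^ m - 1) / (fact (m + 1) :: real)"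
  have c: "0 \<le> c" unfolding c_def by simp
  have n: "m + 2 \<le> card V" "card V - 1 = n" "k = n - (m + 1)" "m + 1 \<le> n"
    using step.hyps(2) by (auto simp: n_def)
  let ?L = "light_cuts V w B ends ?b"
  have "real (card ?L) \<le> c * falling_bound m \<theta> (card V)"
  proof (cases "\<forall>v\<in>V. \<exists>e\<in>B. fst (ends e) \<noteq> snd (ends e) \<and> (fst (ends e) = v \<or> snd (ends e) = v)")
    \<comment> \<open>Some vertex meets \<open>B\<close> in loops at most; eliminating it loses no
      light cut.\<close>
    case False
    then obtain v where "v \<in> V" and v: "\<forall>e\<in>B. fst (ends e) \<noteq> snd (ends e) \<longrightarrow>
      fst (ends e) \<noteq> v \<and> snd (ends e) \<noteq> v" by blast
    then obtain U where V: "V = insert v U" "v \<notin> U" by (meson Set.set_insert)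
    have U: "finite U" "card U = n" using V step.prems(1) n(2) by auto
    have cond: "conductive U (eliminate U w v) B ends K"
      using conductive_eliminate[OF _ step.prems(2) U(1) V(2) v] step.prems(3) unfolding V(1) .
    have "real (card (light_cuts U (eliminate U w v) B ends ?b)) \<le> c * falling_bound m \<theta> n"
      using step.hyps(1)[of U, OF _ U(1) weights_eliminate[OF step.prems(2)] cond] n(3,4)
      unfolding c_def U(2) by blast
    moreover have "card ?L \<le> card (light_cuts U (eliminate U w v) B ends ?b)"
      unfolding V(1) using light_cuts_eliminate[OF step.prems(2) U(1) V(2) v] finite_light_cuts[OF U(1)]
      by (intro card_mono) auto
    moreover have "c * falling_bound m \<theta> n \<le> c * falling_bound m \<theta> (card V)"
      using falling_bound_mono[OF n(1) assms(5)] assms(6) c unfolding n(2) by (intro mult_left_mono) auto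
    ultimately show "real (card ?L) \<le> c * falling_bound m \<theta> (card V)" by linarith
  next
    case True
    let ?P = "Sigma V (\<lambda>x. V - {x})" and ?w = "\<lambda>p. w (fst p) (snd p)"
    let ?D = "sum ?w ?P"
    have D: "real (card V) * K \<le> ?D"
      using total_weight_ge[OF step.prems(3,2,1)] True by blast
    \<comment> \<open>One light side is fixed for each \<open>F\<close>, so that separation of a
      pair by \<open>F\<close> has a meaning.\<close>
    have "\<forall>F\<in>?L. \<exists>S. S \<subseteq> V \<and> F = cut B ends S \<and> energy V w (\<lambda>x. of_bool (x \<in> S)) \<le> ?b"
      unfolding light_cuts_def by blast
    then obtain S where S: "\<And>F. F \<in> ?L \<Longrightarrow> S F \<subseteq> V" "\<And>F. F \<in> ?L \<Longrightarrow> F = cut B ends (S F)"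
      "\<And>F. F \<in> ?L \<Longrightarrow> energy V w (\<lambda>x. of_bool (x \<in> S F)) \<le> ?b" by metis
    have avg: "real (card ?L) * (?D - ?b) \<le> (c * falling_bound m \<theta> n) * ?D"
    proof (rule card_mult_le_of_average[where R = "\<lambda>F p. (fst p \<in> S F) \<noteq> (snd p \<in> S F)"])
      show "finite ?L" by (rule finite_light_cuts[OF step.prems(1)])
      show "finite ?P" using step.prems(1) by simp
      show "0 \<le> ?w p" for p by (rule weights_nonneg[OF step.prems(2)])
      show "(\<Sum>p\<in>?P. of_bool ((fst p \<in> S F) \<noteq> (snd p \<in> S F)) * ?w p) \<le> ?b" if "F \<in> ?L" for F
        unfolding energy_of_bool[OF step.prems(1)] by (rule S(3)[OF that])
      fix p assume "p \<in> ?P"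
      then obtain a b where p: "p = (a, b)" "a \<in> V" "b \<in> V" "a \<noteq> b" by auto
      let ?L' = "light_cuts (V - {b}) (push_weights V (merge a b) w) B
        (map_prod (merge a b) (merge a b) \<circ> ends) ?b"
      have fin: "finite (V - {b})" and card: "n = card (V - {b})"
        using step.prems(1) p n(2) by auto
      have "{F \<in> ?L. \<not> (fst p \<in> S F) \<noteq> (snd p \<in> S F)} \<subseteq> ?L'"
      proof
        fix F assume "F \<in> {F \<in> ?L. \<not> (fst p \<in> S F) \<noteq> (snd p \<in> S F)}"
        then have F: "F \<in> ?L" "a \<in> S F \<longleftrightarrow> b \<in> S F" using p by auto
        then have "cut B ends (S F) \<noteq> {}" using S(2)[OF F(1)] unfolding light_cuts_def by auto
        then have "cut B ends (S F) \<in> ?L'"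
          by (intro light_cut_merge step.prems(1) p S F)
        then show "F \<in> ?L'" using S(2)[OF F(1)] by simp
      qed
      then have "real (card {F \<in> ?L. \<not> (fst p \<in> S F) \<noteq> (snd p \<in> S F)}) \<le> real (card ?L')"
        using card_mono[OF finite_light_cuts[OF fin]] by (intro of_nat_mono) blast
      also have "\<dots> \<le> c * falling_bound m \<theta> n"
        using step.hyps(1)[of "V - {b}", OF _ fin weights_push[OF step.prems(2)]
            conductive_merge[OF step.prems(3,1) p(2,4)]] n(3,4)
        unfolding c_def card[symmetric] by blast
      finally show "real (card {F \<in> ?L. \<not> (fst p \<in> S F) \<noteq> (snd p \<in> S F)}) \<le> c * falling_bound m \<theta> n" .
    qed
    let ?n = "real (card V)" and ?\<beta> = "real m + \<theta>"
    have n\<beta>: "0 < ?n - ?\<beta>" "0 < ?n" using n(1) assms(6) by linarith+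
    have "0 < ?n * K" using n\<beta>(2) assms(4) by simp
    then have D0: "0 < ?D" using D by linarith
    \<comment> \<open>This is 1 - \<beta>/n \<le> 1 - \<beta>K/D multiplied by nD, a consequence of
      nK \<le> D.\<close>
    have "?D * (?n - ?\<beta>) \<le> ?n * (?D - ?b)"
      using mult_left_mono[OF D, of ?\<beta>] assms(5) by (simp add: algebra_simps)
    then have "real (card ?L) * (?D * (?n - ?\<beta>)) \<le> real (card ?L) * (?n * (?D - ?b))"
      by (intro mult_left_mono) auto
    also have "\<dots> \<le> ?n * (c * falling_bound m \<theta> n * ?D)"
      using mult_left_mono[OF avg, of ?n] by (simp add: mult_ac)
    also have "\<dots> = c * ?D * (?n * falling_bound m \<theta> n)" by simp
    also have "\<dots> \<le> c * ?D * (falling_bound m \<theta> (card V) * (?n - ?\<beta>))"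
      using falling_bound_step[OF n(1) assms(5)] assms(6) c D0 unfolding n(2)
      by (intro mult_left_mono) auto
    finally have "real (card ?L) * (?D * (?n - ?\<beta>))
        \<le> c * falling_bound m \<theta> (card V) * (?D * (?n - ?\<beta>))" by (simp add: mult_ac)
    then show "real (card ?L) \<le> c * falling_bound m \<theta> (card V)"
      using mult_le_cancel_right_pos[of "?D * (?n - ?\<beta>)"] D0 n\<beta>(1) by simp
  qed
  then show ?case unfolding c_def .
qed

lemma card_light_cuts_less:
  assumes "finite V" "V \<noteq> {}" "weights w" "conductive V w B ends K" "0 < K" "0 \<le> \<beta>"
  shows "real (card (light_cuts V w B ends (\<beta> * K))) < real (card V) powr \<beta>"
proof -
  define m where "m = nat \<lfloor>\<beta>\<rfloor>"
  define \<theta> where "\<theta> = \<beta> - real m"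
  have \<beta>: "\<beta> = real m + \<theta>" "0 \<le> \<theta>" "\<theta> < 1"
    using assms(6) unfolding \<theta>_def m_def by (simp_all add: floor_le_iff) linarith+
  have n: "0 < card V" using assms(1,2) by (simp add: card_gt_0_iff)
  show ?thesis
  proof (cases "m + 1 \<le> card V")
    case True
    have f: "falling_bound m \<theta> (card V) > 0" using True by (simp add: falling_bound_def)
    have "real (card (light_cuts V w B ends (\<beta> * K)))
        \<le> (2 ^ m - 1) / fact (m + 1) * falling_bound m \<theta> (card V)"
      using card_light_cuts[OF assms(1,3-5) \<beta>(2,3) True] unfolding \<beta>(1) .
    \<comment> \<open>The constant is below 1 because 2^m - 1 < (m + 1)!.\<close>
    also have "\<dots> < 1 * falling_bound m \<theta> (card V)"
      using two_power_le_fact[of m] f by (intro mult_strict_right_mono) (auto simp: divide_less_eq)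
    also have "\<dots> \<le> real (card V) powr \<beta>"
      using falling_bound_le_powr[of m "card V" \<theta>] True n \<beta> by simp
    finally show ?thesis .
  next
    \<comment> \<open>With at most \<open>m\<close> vertices, the exponent n - 1 of the trivial
      bound is less than \<beta>.\<close>
    case False
    have "real (card (light_cuts V w B ends (\<beta> * K))) \<le> 2 ^ (card V - 1) - 1"
      by (rule card_light_cuts_le[OF assms(1,2,4)])
    also have "\<dots> < 2 ^ (card V - 1)" by simp
    also have "\<dots> \<le> real (card V) ^ (card V - 1)"
      \<comment> \<open>A single vertex gives 1 on both sides; otherwise the base is at least
        2.\<close>
      by (cases "card V = 1") (use n in \<open>auto intro!: power_mono\<close>)
    also have "\<dots> = real (card V) powr real (card V - 1)" by (subst powr_realpow) (use n in simp_all)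
    also have "\<dots> \<le> real (card V) powr \<beta>"
      using False n \<beta> by (intro powr_mono) auto
    finally show ?thesis .
  qed
qed

theorem theorem3p2:
  fixes V :: "'v set" and E B :: "'e set" and ends :: "'e \<Rightarrow> 'v \<times> 'v"
    and K \<alpha> :: real
  assumes "finite V" and "V \<noteq> {}" and "finite E"
    and "\<forall>e \<in> E. fst (ends e) \<in> V \<and> snd (ends e) \<in> V \<and> fst (ends e) \<noteq> snd (ends e)"
    and "B \<subseteq> E"
    and "K > 0"
    and "\<forall>e \<in> B. eff_conductance V E ends (fst (ends e)) (snd (ends e)) \<ge> K"
    and "\<alpha> \<ge> 1"
  shows "real (card {F. cut_induced V E ends B F \<and> real (qval V E ends B F) \<le> \<alpha> * K})
           < real (card V) powr (2 * \<alpha>)"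
proof -
  let ?w = "multiplicity E ends"
  \<comment> \<open>Energy is twice the cut size, so q(F) \<le> \<alpha>K becomes the energy bound
    \<beta>K with \<beta> = 2\<alpha>, which is the exponent.\<close>
  let ?L = "light_cuts V ?w B ends (2 * \<alpha> * K)"
  let ?C = "{F. cut_induced V E ends B F \<and> real (qval V E ends B F) \<le> \<alpha> * K}"
  have ends: "fst (ends e) \<in> V \<and> snd (ends e) \<in> V \<and> fst (ends e) \<noteq> snd (ends e)" if "e \<in> E" for e
    using assms(4) that by blast
  have "2 * K * (\<phi> (fst (ends e)) - \<phi> (snd (ends e)))\<^sup>2 \<le> energy V ?w \<phi>" if e: "e \<in> B" for e \<phi>
  proof -
    let ?c = "eff_conductance V E ends (fst (ends e)) (snd (ends e))"
    have "e \<in> E" using e assms(5) by blast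
    have "2 * K * (\<phi> (fst (ends e)) - \<phi> (snd (ends e)))\<^sup>2
        \<le> 2 * ?c * (\<phi> (fst (ends e)) - \<phi> (snd (ends e)))\<^sup>2"
      using assms(7) e by (intro mult_right_mono) auto
    also have "\<dots> \<le> energy V ?w \<phi>"
      using ends[OF \<open>e \<in> E\<close>] by (intro energy_ge_eff_conductance assms(1,3) ends) auto
    finally show ?thesis .
  qed
  then have cond: "conductive V ?w B ends K"
    unfolding conductive_def using ends assms(5) by blast
  have cut_energy: "energy V ?w (\<lambda>x. of_bool (x \<in> S)) = 2 * real (card (cut E ends S))" for S
  proof -
    have "(\<Sum>e\<in>E. (of_bool (fst (ends e) \<in> S) - of_bool (snd (ends e) \<in> S))\<^sup>2)
        = (\<Sum>e\<in>E. of_bool ((fst (ends e) \<in> S) \<noteq> (snd (ends e) \<in> S)) :: real)"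
      by (intro sum.cong) auto
    also have "\<dots> = real (card (cut E ends S))"
      using assms(3) by (simp add: cut_def Int_def)
    finally show ?thesis using energy_multiplicity[OF assms(1), of E ends] ends by simp
  qed
  have "?C \<subseteq> ?L"
  proof
    fix F assume "F \<in> ?C"
    then have F: "F \<noteq> {}" "\<exists>S. S \<subseteq> V \<and> cut E ends S \<inter> B = F" "real (qval V E ends B F) \<le> \<alpha> * K"
      unfolding cut_induced_def by auto
    let ?M = "{card (cut E ends S) | S. S \<subseteq> V \<and> cut E ends S \<inter> B = F}"
    have "?M \<subseteq> (\<lambda>S. card (cut E ends S)) ` Pow V" by blast
    then have "finite ?M" using assms(1) finite_subset by blast
    \<comment> \<open>The minimum is attained, and a minimising side witnesses that \<open>F\<close>
      is light.\<close>
    then have "qval V E ends B F \<in> ?M" unfolding qval_def using F(2) by (intro Min_in) auto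
    then obtain S where S: "S \<subseteq> V" "cut E ends S \<inter> B = F" "qval V E ends B F = card (cut E ends S)"
      by blast
    have "cut E ends S \<inter> B = cut B ends S" using assms(5) unfolding cut_def by blast
    then show "F \<in> ?L"
      unfolding light_cuts_def cut_energy using S F by auto
  qed
  then have "real (card ?C) \<le> real (card ?L)"
    using card_mono[OF finite_light_cuts[OF assms(1)]] by (intro of_nat_mono)
  also have "\<dots> < real (card V) powr (2 * \<alpha>)"
    using assms(8) by (intro card_light_cuts_less assms(1,2,6) weights_multiplicity cond) auto
  finally show ?thesis .
qed

end
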